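(* For a sequence $\{X_n\}$ of gd-sets, the following conditions are equivalent. (i) $\{X_n\}$ is a function-family Lévy family, i.e. $q(X_n)\to0$. (ii) For every $\kappa\in(0,1)$, $\operatorname{ObsDiam}(X_n;-\kappa)\to0$. (iii) For every $\kappa\in(0,1)$, $\operatorname{Sep}^+(X_n;\kappa,\kappa)\to0$. (iv) For every $r>0$, $\alpha_{X_n}^+(r)\to0$ and $\alpha_{X_n}^-(r)\to0$. If the zero function belongs to $\overline{F_{X_n}}$ for every $n$, then $\operatorname{Sep}^+$ in (iii) can be replaced by $\operatorname{Sep}$.
   Context: A gd-set is a triple $(X,F_X,\mu_X)$, written $X$, where $F_X$ is a nonempty family of functions $X\to\mathbb R$ such that $d_{F_X}(x,x')=\sup_{f\in F_X}|f(x)-f(x')|$ is a complete separable metric on $X$, and $\mu_X$ is a Borel probability measure on $(X,d_{F_X})$ with full support. $\overline{F_X}$ is the pointwise closure of $F_X$ in $\mathbb R^X$. For measurable $f,g\colon X\to\mathbb R$ the Ky Fan distance is $d_{\mathrm{KF}}^{\mu_X}(f,g)=\inf\{\varepsilon\ge0\mid\mu_X(|f-g|>\varepsilon)\le\varepsilon\}$. Put $q(X)=\sup_{f\in\overline{F_X}}\inf_{c\in\mathbb R}d_{\mathrm{KF}}^{\mu_X}(f,c)$, where $c$ also denotes the constant function. $\{X_n\}$ is a function-family Lévy family if $q(X_n)\to0$. For a Borel probability measure $\nu$ on $\mathbb R$ and $\alpha\in(0,1)$, $\operatorname{PartDiam}(\nu;\alpha)=\inf\{\operatorname{diam}B\mid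 B\subset\mathbb R\text{ Borel},\ \nu(B)\ge\alpha\}$. For $\kappa\in(0,1)$, $\operatorname{ObsDiam}(X;-\kappa)=\sup_{f\in\overline{F_X}}\operatorname{PartDiam}(f_*\mu_X;1-\kappa)$. For nonempty $A,B\subset X$, $\sigma^{\to}(X;A,B)=\sup_{f\in\overline{F_X}}\inf_{a\in A,b\in B}(f(b)-f(a))$. For $\kappa_0,\kappa_1\in(0,1)$, $\operatorname{Sep}(X;\kappa_0,\kappa_1)$ is the supremum of $\sigma^{\to}(X;A_0,A_1)$ over all pairs $(A_0,A_1)$ of disjoint Borel subsets of $X$ with $\mu_X(A_i)\ge\kappa_i$ $(i=0,1)$; it is $0$ if there is no such pair. $\operatorname{Sep}^+(X;\kappa_0,\kappa_1)=\max\{0,\operatorname{Sep}(X;\kappa_0,\kappa_1)\}$. For $f\in\overline{F_X}$, $\operatorname{Med}(f)=\{m\in\mathbb R\mid\mu_X(f\le m)\ge1/2,\ \mu_X(f\ge m)\ge1/2\}$. For $r>0$, $$\alpha_X^+(r)=\sup_{f\in\overline{F_X}}\sup_{m\in\operatorname{Med}(f)}\mu_X(f\ge m+r),\qquad\alpha_X^-(r)=\sup_{f\in\overline{F_X}}\sup_{m\in\operatorname{Med}(f)}\mu_X(f\le m-r).$$ *)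

theory Defs
  imports "HOL-Probability.Probability"
begin

text \<open>
  A gd-set is given by a carrier \<open>X\<close>, a family \<open>F\<close> of real functions on \<open>X\<close> and a measure \<open>M\<close>
  on \<open>X\<close>. The space of all real functions on \<open>X\<close> is represented by the extensional functions
  \<open>X \<rightarrow>\<^sub>E UNIV\<close>, so that two elements of it are equal iff they agree on \<open>X\<close>.
\<close>

text \<open>The value \<open>0\<close> off the carrier is a dummy: \<^locale>\<open>Metric_space\<close> demands nonnegativity and symmetry
  on the whole type.\<close>
definition gd_dist :: "'a set \<Rightarrow> ('a \<Rightarrow> real) set \<Rightarrow> 'a \<Rightarrow> 'a \<Rightarrow> real" where
  "gd_dist X F x y = (if x \<in> X \<and> y \<in> X then (SUP f\<in>F. \<bar>f x - f y\<bar>) else 0)"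

definition gd_topology :: "'a set \<Rightarrow> ('a \<Rightarrow> real) set \<Rightarrow> 'a topology" where
  "gd_topology X F = Metric_space.mtopology X (gd_dist X F)"

text \<open>The assumption \<open>finite_dist\<close> says that the supremum defining the distance is finite; without it
  the real-valued \<open>SUP\<close> would be meaningless.\<close>
locale gd_set = prob_space M
  for X :: "'a set" and F :: "('a \<Rightarrow> real) set" and M :: "'a measure" +
  assumes family: "F \<noteq> {}" "F \<subseteq> X \<rightarrow>\<^sub>E UNIV"
    and finite_dist: "\<And>x y. x \<in> X \<Longrightarrow> y \<in> X \<Longrightarrow> bdd_above ((\<lambda>f. \<bar>f x - f y\<bar>) ` F)"
    and metric: "Metric_space X (gd_dist X F)"
    and complete: "Metric_space.mcomplete X (gd_dist X F)"
    and separable: "separable_space (gd_topology X F)"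
    and space_eq: "space M = X"
    and sets_eq: "sets M = sigma_sets X {U. openin (gd_topology X F) U}"
    and full_support: "\<And>U. openin (gd_topology X F) U \<Longrightarrow> U \<noteq> {} \<Longrightarrow> measure M U > 0"

text \<open>The topology of pointwise convergence is the product topology.\<close>
definition gd_closure :: "'a set \<Rightarrow> ('a \<Rightarrow> real) set \<Rightarrow> ('a \<Rightarrow> real) set" where
  "gd_closure X F = product_topology (\<lambda>_. euclideanreal) X closure_of F"

definition ky_fan :: "'a measure \<Rightarrow> ('a \<Rightarrow> real) \<Rightarrow> ('a \<Rightarrow> real) \<Rightarrow> real" where
  "ky_fan M f g = Inf {e. 0 \<le> e \<and> measure M {x \<in> space M. \<bar>f x - g x\<bar> > e} \<le> e}"

text \<open>Ky Fan distances for a probability measure lie in \<open>[0, 1]\<close>, so real suprema and infima suffice.\<close>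
definition gd_q :: "'a set \<Rightarrow> ('a \<Rightarrow> real) set \<Rightarrow> 'a measure \<Rightarrow> real" where
  "gd_q X F M = (SUP f\<in>gd_closure X F. INF c. ky_fan M f (\<lambda>_. c))"

definition function_family_Levy ::
  "(nat \<Rightarrow> 'a set) \<Rightarrow> (nat \<Rightarrow> ('a \<Rightarrow> real) set) \<Rightarrow> (nat \<Rightarrow> 'a measure) \<Rightarrow> bool" where
  "function_family_Levy X F M \<longleftrightarrow> (\<lambda>n. gd_q (X n) (F n) (M n)) \<longlonglongrightarrow> 0"

text \<open>The library's \<^const>\<open>diameter\<close> is real-valued, hence unsuitable for unbounded sets.\<close>
definition ediameter :: "real set \<Rightarrow> ennreal" where
  "ediameter B = (SUP x\<in>B. SUP y\<in>B. ennreal (dist x y))"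

definition PartDiam :: "real measure \<Rightarrow> real \<Rightarrow> ennreal" where
  "PartDiam N \<alpha> = (INF B\<in>{B \<in> sets borel. measure N B \<ge> \<alpha>}. ediameter B)"

text \<open>The last argument \<open>\<kappa>\<close> corresponds to the customary notation \<open>ObsDiam(X; -\<kappa>)\<close>.\<close>
definition ObsDiam :: "'a set \<Rightarrow> ('a \<Rightarrow> real) set \<Rightarrow> 'a measure \<Rightarrow> real \<Rightarrow> ennreal" where
  "ObsDiam X F M \<kappa> = (SUP f\<in>gd_closure X F. PartDiam (distr M borel f) (1 - \<kappa>))"

text \<open>Extended real values: both the infima and the suprema below may be infinite.\<close>
definition dir_sep :: "'a set \<Rightarrow> ('a \<Rightarrow> real) set \<Rightarrow> 'a set \<Rightarrow> 'a set \<Rightarrow> ereal" where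
  "dir_sep X F A B = (SUP f\<in>gd_closure X F. INF a\<in>A. INF b\<in>B. ereal (f b - f a))"

definition sep_pairs :: "'a measure \<Rightarrow> real \<Rightarrow> real \<Rightarrow> ('a set \<times> 'a set) set" where
  "sep_pairs M \<kappa>0 \<kappa>1 = {(A, B). A \<in> sets M \<and> B \<in> sets M \<and> A \<inter> B = {} \<and>
     measure M A \<ge> \<kappa>0 \<and> measure M B \<ge> \<kappa>1}"

definition Sep :: "'a set \<Rightarrow> ('a \<Rightarrow> real) set \<Rightarrow> 'a measure \<Rightarrow> real \<Rightarrow> real \<Rightarrow> ereal" where
  "Sep X F M \<kappa>0 \<kappa>1 = (if sep_pairs M \<kappa>0 \<kappa>1 = {} then 0
     else (SUP (A, B)\<in>sep_pairs M \<kappa>0 \<kappa>1. dir_sep X F A B))"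

definition Sep_plus :: "'a set \<Rightarrow> ('a \<Rightarrow> real) set \<Rightarrow> 'a measure \<Rightarrow> real \<Rightarrow> real \<Rightarrow> ereal" where
  "Sep_plus X F M \<kappa>0 \<kappa>1 = max 0 (Sep X F M \<kappa>0 \<kappa>1)"

definition Med :: "'a measure \<Rightarrow> ('a \<Rightarrow> real) \<Rightarrow> real set" where
  "Med M f = {m. measure M {x \<in> space M. f x \<le> m} \<ge> 1/2 \<and> measure M {x \<in> space M. f x \<ge> m} \<ge> 1/2}"

definition conc_plus :: "'a set \<Rightarrow> ('a \<Rightarrow> real) set \<Rightarrow> 'a measure \<Rightarrow> real \<Rightarrow> real" where
  "conc_plus X F M r =
     (SUP f\<in>gd_closure X F. SUP m\<in>Med M f. measure M {x \<in> space M. f x \<ge> m + r})"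

definition conc_minus :: "'a set \<Rightarrow> ('a \<Rightarrow> real) set \<Rightarrow> 'a measure \<Rightarrow> real \<Rightarrow> real" where
  "conc_minus X F M r =
     (SUP f\<in>gd_closure X F. SUP m\<in>Med M f. measure M {x \<in> space M. f x \<le> m - r})"

end

theory Submission
  imports Defs
begin

text \<open>
  The equivalences run around the cycle (i), (ii), (iii), (iv), (i), each step being an inequality
  for a single gd-set. A constant \<open>c\<close> close to \<open>f\<close> in the Ky Fan metric gives an interval
  around \<open>c\<close> of almost full measure; a set \<open>D\<close> of measure greater than \<open>1 - \<kappa>\<close> for \<open>f\<^sub>*\<mu>\<close> has
  a preimage meeting every pair of sets of measure at least \<open>\<kappa>\<close>; the sets \<open>{f \<le> m}\<close> and
  \<open>{f \<ge> m + r}\<close> are separated by \<open>r\<close>; and small tails on both sides of a median \<open>m\<close> make \<open>f\<close> close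
  to the constant \<open>m\<close>.
\<close>

section \<open>Existence of medians\<close>

lemma (in prob_space) Med_nonempty:
  assumes f: "f \<in> borel_measurable M"
  shows "Med M f \<noteq> {}"
proof -
  define N where "N = distr M borel f"
  interpret N: real_distribution N
    unfolding N_def using f by (rule real_distribution_distr)
  have meas: "measure N A = measure M {x \<in> space M. f x \<in> A}" if "A \<in> sets borel" for A
    unfolding N_def using measure_distr[OF f that] by (simp add: vimage_def Int_def conj_commute)
  \<comment> \<open>The median is the first point where the distribution function reaches 1/2. Right
    continuity gives mass at least 1/2 to \<open>{..m}\<close>; the left limit gives mass at most
    1/2 to \<open>{..<m}\<close>, hence at least 1/2 to its complement \<open>{m..}\<close>.\<close>
  define S where "S = {t. 1/2 \<le> cdf N t}"
  define m where "m = Inf S"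
  have "eventually (\<lambda>t. 1/2 < cdf N t) at_top"
    using N.cdf_lim_at_top_prob by (rule order_tendstoD) simp
  then obtain t where "1/2 < cdf N t"
    using eventually_happens'[OF trivial_limit_at_top_linorder] by blast
  then have ne: "S \<noteq> {}"
    unfolding S_def using less_imp_le by blast
  have "eventually (\<lambda>t. cdf N t < 1/2) at_bot"
    using N.cdf_lim_at_bot by (rule order_tendstoD) simp
  then obtain b where "\<forall>t\<le>b. cdf N t < 1/2"
    unfolding eventually_at_bot_linorder by blast
  then have bdd: "bdd_below S"
    unfolding S_def by (intro bdd_belowI[of _ b]) (metis linear mem_Collect_eq not_le)
  have below: "cdf N t \<le> 1/2" if "t < m" for t
  proof (rule ccontr)
    assume "\<not> ?thesis"
    then have "m \<le> t"
      unfolding m_def by (intro cInf_lower[OF _ bdd]) (simp add: S_def)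
    with that show False by simp
  qed
  have above: "1/2 \<le> cdf N t" if t: "m < t" for t
  proof -
    obtain s where "s \<in> S" "s < t"
      using cInf_lessD[OF ne t[unfolded m_def]] by blast
    then show ?thesis
      using N.cdf_nondecreasing[of s t] by (simp add: S_def)
  qed
  have "1/2 \<le> cdf N m"
  proof (rule tendsto_lowerbound)
    show "(cdf N \<longlongrightarrow> cdf N m) (at_right m)"
      using N.cdf_is_right_cont by (simp add: continuous_within)
    show "\<forall>\<^sub>F t in at_right m. 1/2 \<le> cdf N t"
      using above by (auto simp: eventually_at_filter intro!: always_eventually)
  qed simp
  moreover have "measure N {..<m} \<le> 1/2"
  proof (rule tendsto_upperbound)
    show "(cdf N \<longlongrightarrow> measure N {..<m}) (at_left m)"
      by (rule N.cdf_at_left)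
    show "\<forall>\<^sub>F t in at_left m. cdf N t \<le> 1/2"
      using below by (auto simp: eventually_at_filter intro!: always_eventually)
  qed simp
  moreover have "measure N {m..} = 1 - measure N {..<m}"
    using N.prob_compl[of "{..<m}"] by (simp add: Compl_eq_Diff_UNIV[symmetric])
  ultimately have "m \<in> Med M f"
    unfolding Med_def by (simp add: cdf_def meas)
  then show ?thesis
    by blast
qed

section \<open>Ky Fan distances and diameters\<close>

lemma (in prob_space) ky_fan_le:
  "0 \<le> e \<Longrightarrow> prob {x \<in> space M. e < \<bar>f x - g x\<bar>} \<le> e \<Longrightarrow> ky_fan M f g \<le> e"
  unfolding ky_fan_def by (intro cInf_lower) (auto intro: bdd_belowI[of _ 0])

lemma (in prob_space) ky_fan_nonneg: "0 \<le> ky_fan M f g"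
  unfolding ky_fan_def by (rule cInf_greatest) (auto intro: exI[of _ 1])

text \<open>A strict bound yields an admissible \<open>d\<close> directly, so attainment of the
  infimum never has to be discussed.\<close>

lemma (in prob_space) ky_fan_lessE:
  assumes "ky_fan M f g < e"
  obtains d where "0 \<le> d" "d < e" "prob {x \<in> space M. d < \<bar>f x - g x\<bar>} \<le> d"
proof -
  let ?S = "{d. 0 \<le> d \<and> prob {x \<in> space M. d < \<bar>f x - g x\<bar>} \<le> d}"
  have "1 \<in> ?S" by simp
  then have "?S \<noteq> {}" by blast
  from cInf_lessD[OF this] assms show thesis
    unfolding ky_fan_def using that by blast
qed

lemma ediameter_upper:
  "x \<in> D \<Longrightarrow> y \<in> D \<Longrightarrow> ennreal (dist x y) \<le> ediameter D"
  unfolding ediameter_def by (meson SUP_upper2 order_refl)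

section \<open>Regularity of the functions in the closure\<close>

context gd_set
begin

text \<open>For fixed \<open>x\<close> and \<open>y\<close> the bound involves only two coordinates
  of the function, so it cuts out a closed set of the product topology; this set contains
  \<open>F\<close>.\<close>

lemma closure_dist_le:
  assumes f: "f \<in> gd_closure X F" and xy: "x \<in> X" "y \<in> X"
  shows "\<bar>f x - f y\<bar> \<le> gd_dist X F x y"
proof -
  let ?P = "product_topology (\<lambda>_. euclideanreal) X"
  let ?C = "{g \<in> topspace ?P. \<bar>g x - g y\<bar> \<in> {..gd_dist X F x y}}"
  have "closedin ?P ?C"
    by (rule closedin_continuous_map_preimage[of _ euclideanreal])
      (auto intro!: continuous_intros continuous_map_product_projection xy)
  moreover have "F \<subseteq> ?C"
    using family(2) finite_dist[OF xy] xy
    by (auto simp: gd_dist_def PiE_UNIV_domain intro: cSUP_upper)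
  ultimately show ?thesis
    using closure_of_minimal f unfolding gd_closure_def by blast
qed

text \<open>By \<open>closure_dist_le\<close> the function is 1-Lipschitz: a ball in the image pulls
  back to contain a ball of the same radius. Preimages of open sets are therefore open, and open
  sets generate the \<sigma>-algebra.\<close>

lemma closure_measurable [measurable]:
  assumes f: "f \<in> gd_closure X F"
  shows "f \<in> borel_measurable M"
proof (rule borel_measurableI)
  interpret Metric_space X "gd_dist X F" by (rule metric)
  fix S :: "real set" assume S: "open S"
  have "\<exists>r>0. mball x r \<subseteq> f -` S \<inter> X" if x: "x \<in> X" "f x \<in> S" for x
  proof -
    obtain r where r: "r > 0" "\<And>t. dist t (f x) < r \<Longrightarrow> t \<in> S"
      using S x unfolding open_dist by blast
    have "y \<in> f -` S \<inter> X" if "y \<in> mball x r" for y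
      using that closure_dist_le[OF f x(1), of y] r(2)[of "f y"]
      by (auto simp: in_mball dist_real_def abs_minus_commute)
    then show ?thesis using r(1) by blast
  qed
  then have "openin (gd_topology X F) (f -` S \<inter> X)"
    unfolding gd_topology_def openin_mtopology by auto
  then show "f -` S \<inter> space M \<in> sets M"
    unfolding sets_eq space_eq by (auto intro: sigma_sets.Basic)
qed

lemma closure_nonempty: "gd_closure X F \<noteq> {}"
  using closure_of_subset[of F "product_topology (\<lambda>_. euclideanreal) X"] family
  by (auto simp: gd_closure_def)

lemma closure_Med_nonempty: "f \<in> gd_closure X F \<Longrightarrow> Med M f \<noteq> {}"
  by (intro Med_nonempty closure_measurable)

section \<open>From Ky Fan distance to observable diameter\<close>

lemma INF_ky_fan_le: "(INF c. ky_fan M f (\<lambda>_. c)) \<le> ky_fan M f (\<lambda>_. c)"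
  by (rule cINF_lower) (auto intro!: bdd_belowI[of _ 0] ky_fan_nonneg)

lemma INF_ky_fan_nonneg: "0 \<le> (INF c. ky_fan M f (\<lambda>_. c))"
  by (rule cINF_greatest) (auto simp: ky_fan_nonneg)

lemma INF_ky_fan_le_gd_q:
  assumes "f \<in> gd_closure X F"
  shows "(INF c. ky_fan M f (\<lambda>_. c)) \<le> gd_q X F M"
  unfolding gd_q_def
proof (rule cSUP_upper[OF assms])
  \<comment> \<open>A real supremum bounds its members only if it is over a bounded set; here 1 is
    admissible in every Ky Fan infimum.\<close>
  have "(INF c. ky_fan M g (\<lambda>_. c)) \<le> 1" for g
    by (rule order_trans[OF INF_ky_fan_le[of _ 0] ky_fan_le]) auto
  then show "bdd_above ((\<lambda>f. INF c. ky_fan M f (\<lambda>_. c)) ` gd_closure X F)"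
    by (auto intro: bdd_aboveI[of _ 1])
qed

lemma gd_q_nonneg: "0 \<le> gd_q X F M"
proof -
  obtain f where "f \<in> gd_closure X F"
    using closure_nonempty by blast
  from INF_ky_fan_nonneg INF_ky_fan_le_gd_q[OF this] show ?thesis
    by (rule order_trans)
qed

lemma ObsDiam_le:
  assumes q: "gd_q X F M < e" and e: "e \<le> \<kappa>"
  shows "ObsDiam X F M \<kappa> \<le> ennreal (2 * e)"
  unfolding ObsDiam_def
proof (rule SUP_least)
  fix f assume f: "f \<in> gd_closure X F"
  note [measurable] = closure_measurable[OF f]
  have "(INF c. ky_fan M f (\<lambda>_. c)) < e"
    using INF_ky_fan_le_gd_q[OF f] q by simp
  then obtain c where "ky_fan M f (\<lambda>_. c) < e"
    using cInf_lessD[of "range (\<lambda>c. ky_fan M f (\<lambda>_. c))"] by blast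
  then obtain d where d: "0 \<le> d" "d < e" "prob {x \<in> space M. d < \<bar>f x - c\<bar>} \<le> d"
    by (rule ky_fan_lessE)
  have "measure (distr M borel f) {c - d..c + d} = prob {x \<in> space M. \<not> d < \<bar>f x - c\<bar>}"
    by (subst measure_distr) (auto intro!: arg_cong[where f = prob])
  also have "\<dots> = 1 - prob {x \<in> space M. d < \<bar>f x - c\<bar>}"
    by (rule prob_neg) measurable
  \<comment> \<open>The exceptional mass is at most \<open>d\<close>, and
    \<open>d < e \<le> \<kappa>\<close>; the same \<open>d\<close> makes the interval no longer than
    \<open>2 * e\<close>.\<close>
  finally have "1 - \<kappa> \<le> measure (distr M borel f) {c - d..c + d}"
    using d e by linarith
  then have "PartDiam (distr M borel f) (1 - \<kappa>) \<le> ediameter {c - d..c + d}"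
    unfolding PartDiam_def by (intro INF_lower) simp
  also have "\<dots> \<le> ennreal (2 * e)"
    unfolding ediameter_def using d by (intro SUP_least ennreal_leI) (auto simp: dist_real_def)
  finally show "PartDiam (distr M borel f) (1 - \<kappa>) \<le> ennreal (2 * e)" .
qed

section \<open>From observable diameter to separation\<close>

lemma dir_sep_le_ObsDiam:
  assumes AB: "(A, B) \<in> sep_pairs M \<kappa> \<kappa>" and \<kappa>: "\<kappa>' < \<kappa>"
  shows "dir_sep X F A B \<le> enn2ereal (ObsDiam X F M \<kappa>')"
  unfolding dir_sep_def
proof (rule SUP_least)
  fix f assume f: "f \<in> gd_closure X F"
  note [measurable] = closure_measurable[OF f]
  let ?s = "INF a\<in>A. INF b\<in>B. ereal (f b - f a)"
  \<comment> \<open>Diameters live in \<open>ennreal\<close> while \<open>?s\<close> may be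
    negative, so \<open>?s\<close> is truncated at 0 for the comparison.\<close>
  have "e2ennreal ?s \<le> ediameter D"
    if D: "D \<in> sets borel" "1 - \<kappa>' \<le> measure (distr M borel f) D" for D
  proof -
    \<comment> \<open>Otherwise the preimage of \<open>D\<close> and \<open>E\<close> would be
      disjoint with total mass at least \<open>1 - \<kappa>' + \<kappa>\<close>, which exceeds 1
      because \<open>\<kappa>' < \<kappa>\<close> is strict.\<close>
    have meets: "\<exists>a\<in>E. f a \<in> D" if E: "E \<in> sets M" "\<kappa> \<le> prob E" for E
    proof (rule ccontr)
      assume "\<not> ?thesis"
      then have "f -` D \<inter> space M \<inter> E = {}" by blast
      then have "prob (f -` D \<inter> space M \<union> E) = measure (distr M borel f) D + prob E"
        using E D by (subst finite_measure_Union) (auto simp: measure_distr)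
      then show False
        using E D \<kappa> prob_le_1[of "f -` D \<inter> space M \<union> E"] by linarith
    qed
    obtain a b where ab: "a \<in> A" "f a \<in> D" "b \<in> B" "f b \<in> D"
      using meets[of A] meets[of B] AB unfolding sep_pairs_def by blast
    have "?s \<le> ereal (f b - f a)"
      using ab by (intro INF_lower2[of a] INF_lower2[of b]) auto
    also have "\<dots> \<le> ereal (dist (f b) (f a))"
      by (simp add: dist_real_def)
    finally have "e2ennreal ?s \<le> ennreal (dist (f b) (f a))"
      using e2ennreal_mono by (metis e2ennreal_ereal)
    also have "\<dots> \<le> ediameter D"
      using ab by (intro ediameter_upper)
    finally show ?thesis .
  qed
  then have "e2ennreal ?s \<le> PartDiam (distr M borel f) (1 - \<kappa>')"
    unfolding PartDiam_def by (intro INF_greatest) auto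
  also have "\<dots> \<le> ObsDiam X F M \<kappa>'"
    unfolding ObsDiam_def using f by (rule SUP_upper)
  finally have "enn2ereal (e2ennreal ?s) \<le> enn2ereal (ObsDiam X F M \<kappa>')"
    by (simp add: less_eq_ennreal.rep_eq)
  \<comment> \<open>Truncation changes nothing when \<open>?s\<close> is nonnegative; a negative
    \<open>?s\<close> lies below the nonnegative right-hand side anyway.\<close>
  then show "?s \<le> enn2ereal (ObsDiam X F M \<kappa>')"
    using enn2ereal_e2ennreal[of ?s] enn2ereal_nonneg[of "ObsDiam X F M \<kappa>'"]
    by (cases "0 \<le> ?s") (simp, meson linear order_trans)
qed

text \<open>Both zeros, the one in the maximum and the default in the absence of pairs, are covered
  by nonnegativity of the observable diameter.\<close>

lemma Sep_plus_le_ObsDiam: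
  "\<kappa>' < \<kappa> \<Longrightarrow> Sep_plus X F M \<kappa> \<kappa> \<le> enn2ereal (ObsDiam X F M \<kappa>')"
  unfolding Sep_plus_def Sep_def by (auto intro!: SUP_least dir_sep_le_ObsDiam)

lemma dir_sep_le_Sep_plus:
  assumes "(A, B) \<in> sep_pairs M \<kappa>0 \<kappa>1"
  shows "dir_sep X F A B \<le> Sep_plus X F M \<kappa>0 \<kappa>1"
proof -
  have "dir_sep X F A B \<le> (SUP (A, B)\<in>sep_pairs M \<kappa>0 \<kappa>1. dir_sep X F A B)"
    by (rule SUP_upper2[OF assms]) simp
  then show ?thesis
    using assms unfolding Sep_plus_def Sep_def by (auto simp: le_max_iff_disj)
qed

text \<open>The sublevel set at \<open>s\<close> and the superlevel set at \<open>s + r\<close> are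
  disjoint since \<open>r > 0\<close>, and \<open>f\<close> itself witnesses their
  separation.\<close>

lemma Sep_plus_ge:
  assumes f: "f \<in> gd_closure X F" and r: "0 < r"
    and A: "\<kappa>0 \<le> prob {x \<in> space M. f x \<le> s}"
    and B: "\<kappa>1 \<le> prob {x \<in> space M. s + r \<le> f x}"
  shows "ereal r \<le> Sep_plus X F M \<kappa>0 \<kappa>1"
proof -
  note [measurable] = closure_measurable[OF f]
  let ?A = "{x \<in> space M. f x \<le> s}" and ?B = "{x \<in> space M. s + r \<le> f x}"
  have "ereal r \<le> (INF a\<in>?A. INF b\<in>?B. ereal (f b - f a))"
    by (intro INF_greatest) auto
  also have "\<dots> \<le> dir_sep X F ?A ?B"
    unfolding dir_sep_def using f by (rule SUP_upper)
  also have "\<dots> \<le> Sep_plus X F M \<kappa>0 \<kappa>1"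
    using A B r by (intro dir_sep_le_Sep_plus) (auto simp: sep_pairs_def)
  finally show ?thesis .
qed

section \<open>From separation to concentration around medians\<close>

lemma conc_plus_le:
  assumes sep: "Sep_plus X F M \<kappa> \<kappa> < ereal r" and r: "0 < r" and \<kappa>: "\<kappa> \<le> 1/2"
  shows "conc_plus X F M r \<le> \<kappa>"
  unfolding conc_plus_def
proof (intro cSUP_least closure_nonempty closure_Med_nonempty)
  fix f m assume f: "f \<in> gd_closure X F" and m: "m \<in> Med M f"
  show "prob {x \<in> space M. m + r \<le> f x} \<le> \<kappa>"
    \<comment> \<open>Cutting at \<open>m\<close>, the lower set has mass at least 1/2, hence at
      least \<open>\<kappa>\<close>. An upper tail heavier than \<open>\<kappa>\<close> would force
      separation at least \<open>r\<close>.\<close>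
    using Sep_plus_ge[OF f r, of \<kappa> m \<kappa>] sep \<kappa> m unfolding Med_def by force
qed

lemma conc_minus_le:
  assumes sep: "Sep_plus X F M \<kappa> \<kappa> < ereal r" and r: "0 < r" and \<kappa>: "\<kappa> \<le> 1/2"
  shows "conc_minus X F M r \<le> \<kappa>"
  unfolding conc_minus_def
proof (intro cSUP_least closure_nonempty closure_Med_nonempty)
  fix f m assume f: "f \<in> gd_closure X F" and m: "m \<in> Med M f"
  show "prob {x \<in> space M. f x \<le> m - r} \<le> \<kappa>"
    \<comment> \<open>The cut moves to \<open>m - r\<close>, so that the superlevel set is now the
      half at the median and the sublevel set is the tail.\<close>
    using Sep_plus_ge[OF f r, of \<kappa> "m - r" \<kappa>] sep \<kappa> m unfolding Med_def by force
qed

text \<open>Both real suprema are bounded by 1; for the outer one this relies on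
  \<open>Med M f\<close> being nonempty, since a supremum over the empty set has no controlled
  value.\<close>

lemma prob_le_nested_SUP:
  assumes f: "f \<in> gd_closure X F" and m: "m \<in> Med M f"
  shows "prob (E f m) \<le> (SUP f\<in>gd_closure X F. SUP m\<in>Med M f. prob (E f m))"
proof -
  have bdd: "bdd_above ((\<lambda>m. prob (E g m)) ` Med M g)" for g
    by (auto intro: bdd_aboveI[of _ 1])
  have "prob (E f m) \<le> (SUP m\<in>Med M f. prob (E f m))"
    by (rule cSUP_upper[OF m bdd])
  also have "\<dots> \<le> (SUP f\<in>gd_closure X F. SUP m\<in>Med M f. prob (E f m))"
    by (rule cSUP_upper[OF f])
      (auto intro!: bdd_aboveI[of _ 1] cSUP_least closure_Med_nonempty)
  finally show ?thesis .
qed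

lemma
  assumes f: "f \<in> gd_closure X F" and m: "m \<in> Med M f"
  shows prob_le_conc_plus: "prob {x \<in> space M. m + r \<le> f x} \<le> conc_plus X F M r"
    and prob_le_conc_minus: "prob {x \<in> space M. f x \<le> m - r} \<le> conc_minus X F M r"
  unfolding conc_plus_def conc_minus_def
  using prob_le_nested_SUP[OF f m, of "\<lambda>f m. {x \<in> space M. m + r \<le> f x}"]
    prob_le_nested_SUP[OF f m, of "\<lambda>f m. {x \<in> space M. f x \<le> m - r}"]
  by simp_all

lemma
  shows conc_plus_nonneg: "0 \<le> conc_plus X F M r"
    and conc_minus_nonneg: "0 \<le> conc_minus X F M r"
proof -
  obtain f m where fm: "f \<in> gd_closure X F" "m \<in> Med M f"
    using closure_nonempty closure_Med_nonempty by blast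
  show "0 \<le> conc_plus X F M r" "0 \<le> conc_minus X F M r"
    using prob_le_conc_plus[OF fm] prob_le_conc_minus[OF fm] measure_nonneg order_trans by blast+
qed

text \<open>The number \<open>e\<close> serves twice, as tail distance and as bound on the tail
  mass, matching the two roles of \<epsilon> in the Ky Fan distance. A median is the competing
  constant.\<close>

lemma gd_q_le:
  assumes e: "conc_plus X F M e + conc_minus X F M e \<le> e"
  shows "gd_q X F M \<le> e"
  unfolding gd_q_def
proof (rule cSUP_least[OF closure_nonempty])
  fix f assume f: "f \<in> gd_closure X F"
  note [measurable] = closure_measurable[OF f]
  obtain m where m: "m \<in> Med M f"
    using closure_Med_nonempty[OF f] by blast
  let ?U = "{x \<in> space M. m + e \<le> f x}" and ?L = "{x \<in> space M. f x \<le> m - e}"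
  have "prob {x \<in> space M. e < \<bar>f x - m\<bar>} \<le> prob (?U \<union> ?L)"
    by (rule finite_measure_mono) auto
  also have "\<dots> \<le> prob ?U + prob ?L"
    by (rule measure_Un_le) measurable
  also have "\<dots> \<le> e"
    using prob_le_conc_plus[OF f m, of e] prob_le_conc_minus[OF f m, of e] e by linarith
  finally have "ky_fan M f (\<lambda>_. m) \<le> e"
    using e conc_plus_nonneg[of e] conc_minus_nonneg[of e] by (intro ky_fan_le) auto
  with INF_ky_fan_le[of f m] show "(INF c. ky_fan M f (\<lambda>_. c)) \<le> e"
    by linarith
qed

text \<open>The zero function contributes 0 to every pair, so \<open>Sep\<close> is nonnegative as
  soon as a pair exists; without pairs both sides are 0.\<close>

lemma Sep_plus_eq_Sep:
  assumes zero: "(\<lambda>x\<in>X. 0) \<in> gd_closure X F"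
  shows "Sep_plus X F M \<kappa>0 \<kappa>1 = Sep X F M \<kappa>0 \<kappa>1"
proof (cases "sep_pairs M \<kappa>0 \<kappa>1 = {}")
  case False
  then obtain A B where AB: "(A, B) \<in> sep_pairs M \<kappa>0 \<kappa>1" by auto
  \<comment> \<open>The restricted zero function takes the value 0 only on \<open>X\<close>; off
    \<open>X\<close> it is \<open>undefined\<close>.\<close>
  then have "A \<subseteq> X" "B \<subseteq> X"
    unfolding sep_pairs_def using sets.sets_into_space space_eq by auto
  then have "0 \<le> (INF a\<in>A. INF b\<in>B. ereal ((\<lambda>x\<in>X. 0) b - (\<lambda>x\<in>X. 0) a))"
    by (intro INF_greatest) (auto simp: subset_iff)
  also have "\<dots> \<le> dir_sep X F A B"
    unfolding dir_sep_def using zero by (rule SUP_upper)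
  also have "\<dots> \<le> (SUP (A, B)\<in>sep_pairs M \<kappa>0 \<kappa>1. dir_sep X F A B)"
    by (rule SUP_upper2[OF AB]) simp
  finally show ?thesis
    using False unfolding Sep_plus_def Sep_def by (simp add: max_absorb2)
qed (simp add: Sep_plus_def Sep_def)

end

section \<open>The cycle of limits for sequences\<close>

theorem corollary5p6:
  fixes X :: "nat \<Rightarrow> 'a set" and F :: "nat \<Rightarrow> ('a \<Rightarrow> real) set" and M :: "nat \<Rightarrow> 'a measure"
  assumes "\<And>n. gd_set (X n) (F n) (M n)"
  shows "(function_family_Levy X F M \<longleftrightarrow>
      (\<forall>\<kappa>\<in>{0<..<1}. (\<lambda>n. ObsDiam (X n) (F n) (M n) \<kappa>) \<longlonglongrightarrow> 0)) \<and>
    (function_family_Levy X F M \<longleftrightarrow>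
      (\<forall>\<kappa>\<in>{0<..<1}. (\<lambda>n. Sep_plus (X n) (F n) (M n) \<kappa> \<kappa>) \<longlonglongrightarrow> 0)) \<and>
    (function_family_Levy X F M \<longleftrightarrow>
      (\<forall>r>0. (\<lambda>n. conc_plus (X n) (F n) (M n) r) \<longlonglongrightarrow> 0 \<and>
             (\<lambda>n. conc_minus (X n) (F n) (M n) r) \<longlonglongrightarrow> 0)) \<and>
    ((\<forall>n. (\<lambda>x\<in>X n. 0) \<in> gd_closure (X n) (F n)) \<longrightarrow>
      (function_family_Levy X F M \<longleftrightarrow>
        (\<forall>\<kappa>\<in>{0<..<1}. (\<lambda>n. Sep (X n) (F n) (M n) \<kappa> \<kappa>) \<longlonglongrightarrow> 0)))"
proof -
  let ?q = "\<lambda>n. gd_q (X n) (F n) (M n)"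
  let ?O = "\<lambda>\<kappa> n. ObsDiam (X n) (F n) (M n) \<kappa>"
  let ?S = "\<lambda>\<kappa> n. Sep_plus (X n) (F n) (M n) \<kappa> \<kappa>"
  let ?P = "\<lambda>r n. conc_plus (X n) (F n) (M n) r"
  let ?N = "\<lambda>r n. conc_minus (X n) (F n) (M n) r"
  note gd = assms
  have 1: "?O \<kappa> \<longlonglongrightarrow> 0" if q: "?q \<longlonglongrightarrow> 0" and \<kappa>: "0 < \<kappa>" for \<kappa>
  proof (rule order_tendstoI)
    fix a :: ennreal assume "0 < a"
    then obtain c where c: "0 < c" "c < a"
      using dense by blast
    \<comment> \<open>Since \<open>c\<close> lies strictly below \<open>a\<close>, it is finite even
      if \<open>a\<close> is infinite, and passing to a real number loses nothing.\<close>
    define b where "b = enn2real c"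
    have "c < top" using c(2) top_greatest by (rule order.strict_trans2)
    then have b: "0 < b" "ennreal b < a"
      using c by (auto simp: b_def enn2real_positive_iff)
    \<comment> \<open>\<open>ObsDiam_le\<close> needs \<open>e \<le> \<kappa>\<close>, and its bound
      \<open>2 * e\<close> must not exceed \<open>b\<close>.\<close>
    define e where "e = min \<kappa> (b / 2)"
    have "0 < e" using \<kappa> b by (simp add: e_def)
    with q have "\<forall>\<^sub>F n in sequentially. ?q n < e"
      by (rule order_tendstoD)
    then show "\<forall>\<^sub>F n in sequentially. ?O \<kappa> n < a"
    proof eventually_elim
      case (elim n)
      have "?O \<kappa> n \<le> ennreal (2 * e)"
        by (rule gd_set.ObsDiam_le[OF gd elim]) (simp add: e_def)
      also have "\<dots> \<le> ennreal b"
        by (rule ennreal_leI) (simp add: e_def)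
      finally show ?case using b by simp
    qed
  qed simp
  have 2: "?S \<kappa> \<longlonglongrightarrow> 0" if O: "\<forall>\<kappa>\<in>{0<..<1}. ?O \<kappa> \<longlonglongrightarrow> 0" and \<kappa>: "\<kappa> \<in> {0<..<1}" for \<kappa>
  proof (rule tendsto_sandwich[where f = "\<lambda>_. 0"])
    \<comment> \<open>Any parameter in (0,1) strictly below \<kappa> would do.\<close>
    have "?O (\<kappa> / 2) \<longlonglongrightarrow> 0" using O \<kappa> by simp
    from tendsto_enn2erealI[OF this]
    show "(\<lambda>n. enn2ereal (?O (\<kappa> / 2) n)) \<longlonglongrightarrow> 0"
      by (simp add: zero_ennreal.rep_eq)
    show "\<forall>\<^sub>F n in sequentially. ?S \<kappa> n \<le> enn2ereal (?O (\<kappa> / 2) n)"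
      using \<kappa> by (intro always_eventually allI gd_set.Sep_plus_le_ObsDiam[OF gd]) simp
    show "\<forall>\<^sub>F n in sequentially. 0 \<le> ?S \<kappa> n"
      by (simp add: Sep_plus_def)
  qed simp
  have 3: "?P r \<longlonglongrightarrow> 0 \<and> ?N r \<longlonglongrightarrow> 0" if S: "\<forall>\<kappa>\<in>{0<..<1}. ?S \<kappa> \<longlonglongrightarrow> 0" and r: "0 < r" for r
  proof -
    have ev: "\<forall>\<^sub>F n in sequentially. ?P r n < a \<and> ?N r n < a" if a: "0 < a" for a
    proof -
      \<comment> \<open>The cap 1/2 matches the mass guaranteed at a median; \<open>a / 2\<close>
        turns the weak bounds by \<kappa> into strict bounds by \<open>a\<close>.\<close>
      define \<kappa> where "\<kappa> = min (1/2) (a / 2)"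
      have \<kappa>: "\<kappa> \<in> {0<..<1}" "\<kappa> \<le> 1/2" "\<kappa> < a"
        using a by (auto simp: \<kappa>_def min_def)
      have "?S \<kappa> \<longlonglongrightarrow> 0" using S \<kappa> by blast
      then have "\<forall>\<^sub>F n in sequentially. ?S \<kappa> n < ereal r"
        by (rule order_tendstoD) (simp add: r)
      then show ?thesis
      proof eventually_elim
        case (elim n)
        show ?case
          using gd_set.conc_plus_le[OF gd elim r \<kappa>(2)] gd_set.conc_minus_le[OF gd elim r \<kappa>(2)] \<kappa>(3)
          by linarith
      qed
    qed
    have "?P r \<longlonglongrightarrow> 0"
    proof (rule order_tendstoI)
      show "\<forall>\<^sub>F n in sequentially. a < ?P r n" if "a < 0" for a
        by (intro always_eventually allI less_le_trans[OF that] gd_set.conc_plus_nonneg[OF gd])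
      show "\<forall>\<^sub>F n in sequentially. ?P r n < a" if "0 < a" for a
        using ev[OF that] by (rule eventually_mono) blast
    qed
    moreover have "?N r \<longlonglongrightarrow> 0"
    proof (rule order_tendstoI)
      show "\<forall>\<^sub>F n in sequentially. a < ?N r n" if "a < 0" for a
        by (intro always_eventually allI less_le_trans[OF that] gd_set.conc_minus_nonneg[OF gd])
      show "\<forall>\<^sub>F n in sequentially. ?N r n < a" if "0 < a" for a
        using ev[OF that] by (rule eventually_mono) blast
    qed
    ultimately show ?thesis ..
  qed
  have 4: "?q \<longlonglongrightarrow> 0" if PN: "\<forall>r>0. ?P r \<longlonglongrightarrow> 0 \<and> ?N r \<longlonglongrightarrow> 0"
  proof (rule order_tendstoI)
    fix a :: real assume "a < 0"
    then show "\<forall>\<^sub>F n in sequentially. a < ?q n"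
      by (intro always_eventually allI less_le_trans[OF _ gd_set.gd_q_nonneg[OF gd]])
  next
    fix a :: real assume a: "0 < a"
    have "?P (a / 2) \<longlonglongrightarrow> 0" "?N (a / 2) \<longlonglongrightarrow> 0"
      using PN a by auto
    \<comment> \<open>Two tails below \<open>a / 4\<close> add up to less than the radius
      \<open>a / 2\<close>, as \<open>gd_q_le\<close> requires.\<close>
    from this[THEN order_tendstoD(2), of "a / 4"]
    have "\<forall>\<^sub>F n in sequentially. ?P (a / 2) n < a / 4" "\<forall>\<^sub>F n in sequentially. ?N (a / 2) n < a / 4"
      using a by simp_all
    then show "\<forall>\<^sub>F n in sequentially. ?q n < a"
    proof eventually_elim
      case (elim n)
      have "?q n \<le> a / 2"
        by (rule gd_set.gd_q_le[OF gd]) (use elim in linarith)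
      then show ?case using a by linarith
    qed
  qed
  \<comment> \<open>This runs through the whole cycle; the other equivalences follow from it and the
    adjacent implications.\<close>
  have iii: "function_family_Levy X F M \<longleftrightarrow> (\<forall>\<kappa>\<in>{0<..<1}. ?S \<kappa> \<longlonglongrightarrow> 0)"
    unfolding function_family_Levy_def using 1 2 3 4 by (meson greaterThanLessThan_iff)
  moreover have "function_family_Levy X F M \<longleftrightarrow> (\<forall>\<kappa>\<in>{0<..<1}. ?O \<kappa> \<longlonglongrightarrow> 0)"
    using iii 1 2 unfolding function_family_Levy_def by (meson greaterThanLessThan_iff)
  moreover have "function_family_Levy X F M \<longleftrightarrow> (\<forall>r>0. ?P r \<longlonglongrightarrow> 0 \<and> ?N r \<longlonglongrightarrow> 0)"
    using iii 3 4 unfolding function_family_Levy_def by meson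
  moreover have "?S \<kappa> = (\<lambda>n. Sep (X n) (F n) (M n) \<kappa> \<kappa>)"
    if "\<forall>n. (\<lambda>x\<in>X n. 0) \<in> gd_closure (X n) (F n)" for \<kappa>
    using that gd_set.Sep_plus_eq_Sep[OF gd] by blast
  ultimately show ?thesis
    by simp
qed

end
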